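(* The quasi-order $\big(D_\omega(\mathbf{\Sigma}^0_1)(\mathcal{P}\omega),\leq_w\big)$ has infinite antichains; that is, there exists a sequence $(\mathcal{A}_n)_{n\in\omega}$ of sets in $D_\omega(\mathbf{\Sigma}^0_1)(\mathcal{P}\omega)$ such that $\mathcal{A}_n\not\leq_w\mathcal{A}_m$ for all $n\neq m$.
   Context: The Scott domain $\mathcal{P}\omega$ is the power set of $\omega$ with the topology generated by the basic open sets $\mathcal{O}_F=\{x\subseteq\omega\mid F\subseteq x\}$ for finite $F\subseteq\omega$. For a sequence $(A_\beta)_{\beta<\alpha}$ of subsets of a space, $D_\alpha\big((A_\beta)_{\beta<\alpha}\big)=\bigcup\{A_\beta\setminus\bigcup_{\gamma<\beta}A_\gamma \mid \beta<\alpha,\ \alpha \text{ and } \beta \text{ have different parities}\}$ (limit ordinals are even); $D_\omega(\mathbf{\Sigma}^0_1)(\mathcal{P}\omega)$ is the class of all sets $D_\omega\big((A_n)_{n<\omega}\big)$ with every $A_n$ open in $\mathcal{P}\omega$. For $\mathcal{A},\mathcal{B}\subseteq\mathcal{P}\omega$, $\mathcal{A}\leq_w\mathcal{B}$ (Wadge reducibility) means there is a continuous $f:\mathcal{P}\omega\to\mathcal{P}\omega$ with $f^{-1}[\mathcal{B}]=\mathcal{A}$. *)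

theory Defs
  imports "HOL-Analysis.Analysis"
begin

definition scott_basic :: "nat set \<Rightarrow> nat set set" where
  "scott_basic F = {x. F \<subseteq> x}"

definition scott_domain :: "nat set topology" where
  "scott_domain = topology_generated_by {scott_basic F | F. finite F}"

lemma topspace_scott_domain [simp]: "topspace scott_domain = UNIV"
proof -
  have "scott_basic {} \<in> {scott_basic F | F. finite F}" by blast
  moreover have "scott_basic {} = UNIV" by (simp add: scott_basic_def)
  ultimately show ?thesis
    unfolding scott_domain_def topology_generated_by_topspace by blast
qed

text \<open>
  The difference operation at the limit ordinal \<open>\<omega>\<close>. Limit ordinals are even, so an
  index \<open>n < \<omega>\<close> has parity different from that of \<open>\<omega>\<close> exactly when \<open>n\<close> is odd.
\<close>

definition diff_omega :: "(nat \<Rightarrow> 'a set) \<Rightarrow> 'a set" where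
  "diff_omega A = \<Union> {A n - (\<Union>m<n. A m) | n. odd n}"

definition D_omega_Sigma01 :: "'a topology \<Rightarrow> 'a set set" where
  "D_omega_Sigma01 X = {diff_omega A | A. \<forall>n. openin X (A n)}"

definition wadge_le :: "'a topology \<Rightarrow> 'a set \<Rightarrow> 'a set \<Rightarrow> bool" where
  "wadge_le X A B \<longleftrightarrow>
     (\<exists>f. continuous_map X X f \<and> {x \<in> topspace X. f x \<in> B} = A)"

end

theory Submission
  imports Defs "HOL-Library.Nat_Bijection"
begin

text \<open>
  Given a weight \<open>g\<close> on the natural numbers, colour a poset made of a bottom, a top, pairwise
  disjoint alternating chains of length about \<open>g i\<close> (one for every \<open>i\<close>) and, for every \<open>i\<close>, one
  point above the feet of the chains \<open>i\<close> and \<open>i + 1\<close>. A reduction sends the foot of chain \<open>i\<close>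
  into a chain \<open>p i\<close> of at least about the same length, and because of the connecting points
  \<open>p\<close> moves by at most one step at a time, so \<open>p i \<le> p 0 + i\<close>. Hence \<open>g i \<le> h (p i) + 2\<close>
  must hold for some such \<open>p\<close>, which fails for weights with peaks at far apart and pairwise
  disjoint places.
\<close>

lemma openin_scott_basic: "finite F \<Longrightarrow> openin scott_domain (scott_basic F)"
  unfolding scott_domain_def by (rule topology_generated_by_Basis) blast

lemma openin_scott_upward_closed:
  assumes "openin scott_domain U" "x \<in> U" "x \<subseteq> y"
  shows "y \<in> U"
proof -
  have "generate_topology_on {scott_basic F | F. finite F} U"
    using assms(1) by (simp add: scott_domain_def openin_topology_generated_by_iff)
  then have "x \<in> U \<longrightarrow> y \<in> U"
    using assms(3) by induction (auto simp: scott_basic_def)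
  then show ?thesis
    using assms(2) by blast
qed

text \<open>Open sets are upward closed and the sets \<open>scott_basic {a}\<close> are open.
  Monotonicity is all that the argument takes from continuity.\<close>

lemma continuous_map_scott_mono:
  assumes "continuous_map scott_domain scott_domain f"
  shows "mono f"
proof (rule monoI, rule subsetI)
  fix x y a
  assume "x \<subseteq> y" "a \<in> f x"
  have "openin scott_domain {z \<in> topspace scott_domain. f z \<in> scott_basic {a}}"
    using assms by (rule openin_continuous_map_preimage) (simp add: openin_scott_basic)
  moreover have "x \<in> {z \<in> topspace scott_domain. f z \<in> scott_basic {a}}"
    using \<open>a \<in> f x\<close> by (simp add: scott_basic_def)
  ultimately have "y \<in> {z \<in> topspace scott_domain. f z \<in> scott_basic {a}}"
    using \<open>x \<subseteq> y\<close> by (rule openin_scott_upward_closed)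
  then show "a \<in> f y"
    by (simp add: scott_basic_def)
qed

text \<open>The level of a point; its parity is the colour of the point. Points outside all layers
  have no level.\<close>

definition first_at :: "(nat \<Rightarrow> 'a set) \<Rightarrow> nat \<Rightarrow> 'a \<Rightarrow> bool" where
  "first_at U n x \<longleftrightarrow> x \<in> U n \<and> (\<forall>m<n. x \<notin> U m)"

lemma mem_diff_omega_iff: "x \<in> diff_omega U \<longleftrightarrow> (\<exists>n. odd n \<and> first_at U n x)"
  by (auto simp: diff_omega_def first_at_def)

lemma first_at_unique: "first_at U n x \<Longrightarrow> first_at U m x \<Longrightarrow> n = m"
  unfolding first_at_def by (metis linorder_neqE_nat)

lemma first_at_le: "x \<in> U n \<Longrightarrow> \<exists>m\<le>n. first_at U m x"
  unfolding first_at_def using ex_least_nat_le[of "\<lambda>m. x \<in> U m" n] by blast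

lemma first_at_mem_diff_omega: "first_at U n x \<Longrightarrow> x \<in> diff_omega U \<longleftrightarrow> odd n"
  unfolding mem_diff_omega_iff by (metis first_at_unique)

text \<open>
  The number \<open>2 * i\<close> in a point selects chain \<open>i\<close>, and \<open>2 * t + 1\<close> says that the point lies at
  distance at most \<open>t\<close> below the end of its chain; this is ignored when \<open>t\<close> exceeds the length
  \<open>g i\<close>. Layer 1 is the top, where non-neighbouring chains have been joined, and layer 2
  contains the points connecting two neighbouring chains.
\<close>

definition layer :: "(nat \<Rightarrow> nat) \<Rightarrow> nat \<Rightarrow> nat set set" where
  "layer g n = \<Union> {scott_basic F | F. \<exists>i j.
     F = {2 * i, 2 * j} \<and> n = 1 \<and> i + 1 < j \<or>
     F = {2 * i, 2 * j} \<and> n = 2 \<and> i < j \<or>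
     F = {2 * i, 2 * j + 1} \<and> 3 \<le> n \<and> j \<le> n \<and> j \<le> g i}"

lemma mem_layer_iff: "x \<in> layer g n \<longleftrightarrow> (\<exists>i j. 2 * i \<in> x \<and>
     (n = 1 \<and> i + 1 < j \<and> 2 * j \<in> x \<or> n = 2 \<and> i < j \<and> 2 * j \<in> x \<or>
      3 \<le> n \<and> j \<le> n \<and> j \<le> g i \<and> 2 * j + 1 \<in> x))"
proof -
  have "x \<in> layer g n \<longleftrightarrow> (\<exists>i j.
     {2 * i, 2 * j} \<subseteq> x \<and> n = 1 \<and> i + 1 < j \<or>
     {2 * i, 2 * j} \<subseteq> x \<and> n = 2 \<and> i < j \<or>
     {2 * i, 2 * j + 1} \<subseteq> x \<and> 3 \<le> n \<and> j \<le> n \<and> j \<le> g i)"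
    unfolding layer_def scott_basic_def by blast
  then show ?thesis
    by (simp only:) (intro iff_exI, blast)
qed

lemma openin_layer: "openin scott_domain (layer g n)"
  unfolding layer_def by (rule openin_Union) (auto intro!: openin_scott_basic)

lemma layer_mono: "x \<in> layer g n \<Longrightarrow> x \<subseteq> y \<Longrightarrow> y \<in> layer g n"
  using openin_layer by (rule openin_scott_upward_closed)

lemma layer_0: "layer g 0 = {}"
  by (auto simp: mem_layer_iff)

text \<open>Keeping every \<open>s\<close> from \<open>t\<close> up to \<open>g i\<close> makes the
  links of one chain decrease as \<open>t\<close> grows.\<close>

definition link :: "(nat \<Rightarrow> nat) \<Rightarrow> nat \<Rightarrow> nat \<Rightarrow> nat set" where
  "link g i t = insert (2 * i) {2 * s + 1 | s. t \<le> s \<and> s \<le> g i}"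

lemma double_mem_link [simp]: "2 * a \<in> link g i t \<longleftrightarrow> a = i"
  unfolding link_def by (auto; presburger)

lemma Suc_double_mem_link [simp]: "Suc (2 * a) \<in> link g i t \<longleftrightarrow> t \<le> a \<and> a \<le> g i"
  unfolding link_def by (auto; presburger)

lemma first_at_link: "3 \<le> t \<Longrightarrow> t \<le> g i \<Longrightarrow> first_at (layer g) t (link g i t)"
  unfolding first_at_def mem_layer_iff by auto

lemma first_at_join: "first_at (layer g) 2 (link g i t \<union> link g (Suc i) u)"
proof -
  let ?x = "link g i t \<union> link g (Suc i) u"
  have "2 * a \<in> ?x \<longleftrightarrow> a = i \<or> a = Suc i" for a
    by simp
  then show ?thesis
    unfolding first_at_def mem_layer_iff by (simp only: less_2_cases_iff) auto
qed

lemma reduction_step_function: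
  assumes "mono f"
    and red: "\<And>x. f x \<in> diff_omega (layer h) \<longleftrightarrow> x \<in> diff_omega (layer g)"
    and g: "\<And>i. odd (g i)" "\<And>i. 5 \<le> g i"
    and h: "\<And>i. 3 \<le> h i"
  obtains p where "\<And>i. p (Suc i) \<le> p i + 1" "\<And>i. g i \<le> h (p i) + 2"
proof -
  define foot where "foot i = link g i (g i)" for i
  have parity: "odd n \<longleftrightarrow> odd t"
    if "first_at (layer h) n (f x)" "first_at (layer g) t x" for n t x
    using that red[of x] by (simp add: first_at_mem_diff_omega)
  \<comment> \<open>Colours alternate along a chain, so each step down strictly increases the level of the image.\<close>
  have level: "t \<le> n + 2" if "3 \<le> t" "t \<le> g i" "first_at (layer h) n (f (link g i t))" for i t n
    using that
  proof (induction t arbitrary: n rule: nat_induct_at_least)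
    case base
    then have "odd n"
      using parity[OF base(2) first_at_link] by simp
    \<comment> \<open>Being odd, \<open>n\<close> is at least 1; this is the origin of the slack
      2.\<close>
    then show ?case
      by (cases n) auto
  next
    case (Suc t)
    have "f (link g i (Suc t)) \<subseteq> f (link g i t)"
      using \<open>mono f\<close> by (rule monoD) (auto simp: link_def)
    then have "f (link g i t) \<in> layer h n"
      using Suc.prems(2) layer_mono unfolding first_at_def by blast
    then obtain m where m: "m \<le> n" "first_at (layer h) m (f (link g i t))"
      using first_at_le[of _ "layer h"] by blast
    have "odd m \<longleftrightarrow> odd t" "odd n \<longleftrightarrow> odd (Suc t)"
      using parity[OF m(2) first_at_link] parity[OF Suc.prems(2) first_at_link] Suc.prems Suc.hyps
      by simp_all
    then have "m \<noteq> n"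
      by auto
    then show ?case
      using Suc.IH[OF _ m(2)] Suc.prems(1) m(1) by simp
  qed
  have "\<exists>p. 2 * p \<in> f (foot i) \<and> g i \<le> h p + 2" for i
  proof -
    have foot: "first_at (layer g) (g i) (foot i)"
      using first_at_link[of "g i" g i] g(2)[of i] by (simp add: foot_def)
    then have "f (foot i) \<in> diff_omega (layer h)"
      using red g(1) by (simp add: first_at_mem_diff_omega)
    then obtain n where n: "first_at (layer h) n (f (foot i))"
      by (auto simp: mem_diff_omega_iff)
    have "g i \<le> n + 2"
      using level[of "g i" i n] g(2)[of i] n by (simp add: foot_def)
    then have "3 \<le> n"
      using g(2)[of i] by linarith
    then obtain p t where p: "2 * p \<in> f (foot i)" "t \<le> h p" "2 * t + 1 \<in> f (foot i)"
      using n unfolding first_at_def mem_layer_iff by auto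
    \<comment> \<open>The maximum is needed because \<open>t\<close> may be below 3, where layers
      have another meaning; \<open>3 \<le> h p\<close> still gives
      \<open>n \<le> h p\<close>.\<close>
    then have "f (foot i) \<in> layer h (max 3 t)"
      unfolding mem_layer_iff by (metis max.cobounded1 max.cobounded2)
    then have "n \<le> max 3 t"
      using n unfolding first_at_def by (meson not_le)
    then show ?thesis
      using p h[of p] \<open>g i \<le> n + 2\<close> by (intro exI[of _ p]) linarith
  qed
  then obtain p where p: "\<And>i. 2 * p i \<in> f (foot i)" "\<And>i. g i \<le> h (p i) + 2"
    by metis
  have "p (Suc i) \<le> p i + 1" for i
  proof (rule ccontr)
    assume far: "\<not> p (Suc i) \<le> p i + 1"
    define join where "join = foot i \<union> foot (Suc i)"
    have "2 * p i \<in> f join" "2 * p (Suc i) \<in> f join"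
      using p(1) monoD[OF \<open>mono f\<close>, of _ join] unfolding join_def by blast+
    \<comment> \<open>Non-neighbouring chains met in the image force the odd level 1, whereas
      \<open>join\<close> has the even level 2.\<close>
    then have "f join \<in> layer h 1"
      using far unfolding mem_layer_iff by (metis not_le)
    then have "first_at (layer h) 1 (f join)"
      by (simp add: first_at_def layer_0)
    moreover have "first_at (layer g) 2 join"
      unfolding join_def foot_def by (rule first_at_join)
    ultimately show False
      using parity[of 1 join 2] by simp
  qed
  then show thesis
    using p(2) that by blast
qed

text \<open>Pairing gives distinct \<open>n\<close> disjoint peak positions, and squaring makes the
  gaps outgrow any fixed shift. The factor 2 keeps all values odd, so every foot lies in the
  set.\<close>

definition peaks :: "nat \<Rightarrow> nat \<Rightarrow> nat" where
  "peaks n i = (if \<exists>k. i = (prod_encode (n, k))\<^sup>2 then 2 * i + 5 else 5)"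

lemma peaks_not_dominated:
  assumes "n \<noteq> m"
    and step: "\<And>i. p (Suc i) \<le> p i + 1"
    and dom: "\<And>i. peaks n i \<le> peaks m (p i) + 2"
  shows False
proof -
  \<comment> \<open>A peak of \<open>n\<close> so far out that the gap to the next square exceeds
    \<open>p 0\<close>.\<close>
  define s where "s = prod_encode (n, p 0 + 2)"
  have "p 0 + 2 \<le> s"
    unfolding s_def by (rule le_prod_encode_2)
  have p_le: "p i \<le> p 0 + i" for i
  proof (induction i)
    case (Suc i)
    then show ?case
      using step[of i] by simp
  qed simp
  have "peaks n (s\<^sup>2) = 2 * s\<^sup>2 + 5"
    unfolding peaks_def s_def by auto
  moreover have "2 \<le> s" "p 0 < s"
    using \<open>p 0 + 2 \<le> s\<close> by auto
  moreover have "2 * s \<le> s\<^sup>2"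
    using \<open>2 \<le> s\<close> by (simp add: power2_eq_square)
  ultimately have "5 < peaks m (p (s\<^sup>2))"
    using dom[of "s\<^sup>2"] by linarith
  \<comment> \<open>A value above the base 5 occurs only at a peak of \<open>m\<close>.\<close>
  then obtain k where k: "p (s\<^sup>2) = (prod_encode (m, k))\<^sup>2" "peaks m (p (s\<^sup>2)) = 2 * p (s\<^sup>2) + 5"
    unfolding peaks_def by (auto split: if_splits)
  define t where "t = prod_encode (m, k)"
  have "t \<noteq> s"
    using \<open>n \<noteq> m\<close> by (simp add: t_def s_def)
  have "t\<^sup>2 \<le> p 0 + s\<^sup>2"
    using p_le[of "s\<^sup>2"] k(1) by (simp add: t_def)
  also have "\<dots> < (Suc s)\<^sup>2"
    using \<open>p 0 < s\<close> by (simp add: power2_eq_square)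
  finally have "t < Suc s"
    by (rule power_less_imp_less_base) simp
  then have "Suc t \<le> s"
    using \<open>t \<noteq> s\<close> by simp
  then have "(Suc t)\<^sup>2 \<le> s\<^sup>2"
    by (rule power_mono) simp
  then have "t\<^sup>2 + 2 * t + 1 \<le> s\<^sup>2"
    by (simp add: power2_eq_square)
  \<comment> \<open>Peaks at \<open>s\<^sup>2\<close> and \<open>t\<^sup>2\<close> differ in height
    by twice the distance, so the slack 2 allows distance 1 only.\<close>
  moreover have "s\<^sup>2 \<le> t\<^sup>2 + 1"
    using dom[of "s\<^sup>2"] k \<open>peaks n (s\<^sup>2) = 2 * s\<^sup>2 + 5\<close> by (simp add: t_def)
  ultimately have "t = 0"
    by linarith
  with \<open>s\<^sup>2 \<le> t\<^sup>2 + 1\<close> have "s\<^sup>2 \<le> 1"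
    by simp
  then show False
    using \<open>2 * s \<le> s\<^sup>2\<close> \<open>2 \<le> s\<close> by linarith
qed

theorem theorem40:
  shows "\<exists>\<A> :: nat \<Rightarrow> nat set set.
           (\<forall>n. \<A> n \<in> D_omega_Sigma01 scott_domain) \<and>
           (\<forall>n m. n \<noteq> m \<longrightarrow> \<not> wadge_le scott_domain (\<A> n) (\<A> m))"
proof (intro exI[of _ "\<lambda>n. diff_omega (layer (peaks n))"] conjI allI impI notI)
  show "diff_omega (layer (peaks n)) \<in> D_omega_Sigma01 scott_domain" for n
    using openin_layer unfolding D_omega_Sigma01_def by blast
next
  fix n m :: nat
  assume "n \<noteq> m"
    and "wadge_le scott_domain (diff_omega (layer (peaks n))) (diff_omega (layer (peaks m)))"
  then obtain f where f: "continuous_map scott_domain scott_domain f"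
    and eq: "{x. f x \<in> diff_omega (layer (peaks m))} = diff_omega (layer (peaks n))"
    unfolding wadge_le_def by auto
  have odd_peaks: "odd (peaks n i)" for i
    by (simp add: peaks_def)
  have peaks_ge: "5 \<le> peaks k i" for k i
    by (simp add: peaks_def)
  have "f x \<in> diff_omega (layer (peaks m)) \<longleftrightarrow> x \<in> diff_omega (layer (peaks n))" for x
    using eq by blast
  moreover have "3 \<le> peaks m i" for i
    using peaks_ge[of m i] by linarith
  ultimately obtain p where "\<And>i. p (Suc i) \<le> p i + 1" "\<And>i. peaks n i \<le> peaks m (p i) + 2"
    using reduction_step_function[OF continuous_map_scott_mono[OF f], of "peaks m" "peaks n"]
      odd_peaks peaks_ge by metis
  then show False
    using peaks_not_dominated \<open>n \<noteq> m\<close> by blast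
qed

end
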